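(* Let $(\mathscr{G},\{\circ_\lambda\}_{\lambda\in\Lambda},R_G)$ be a braided dynamical group, $\mathscr{G}=(G,\Lambda,\phi_G)$, and write $R_G(\lambda,a,b)=(a\rightharpoonup_\lambda b,\ a\leftharpoonup_\lambda b)$. Define, for $\lambda\in\Lambda$ and $a,b\in G$, $$a\vartriangleright_\lambda b=a\rightharpoonup_\lambda b,\qquad a\cdot_\lambda b=a\circ_\lambda\big(\bar a^\lambda\rightharpoonup_{\phi_G(\lambda,a)}b\big),$$ where $\bar a^\lambda$ is the inverse of $a$ in the dynamical group $(\mathscr{G},\{\circ_\lambda\})$. Then $(\mathscr{G},\{\cdot_\lambda\}_{\lambda\in\Lambda},\{\vartriangleright_\lambda\}_{\lambda\in\Lambda})$ is a dynamical post-group. Moreover, if $\Psi$ is a homomorphism of braided dynamical groups from $(\mathscr{G},\{\circ_\lambda\},R_G)$ to $(\mathscr{H},\{\circ'_\lambda\},R_H)$, then $\Psi$ is a homomorphism of the corresponding dynamical post-groups from $(\mathscr{G},\{\cdot_\lambda\},\{\vartriangleright_\lambda\})$ to $(\mathscr{H},\{\cdot'_\lambda\},\{\vartriangleright'_\lambda\})$.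
   Context: Fix a non-empty set $\Lambda$. A dynamical set is a triple $\mathscr{X}=(X,\Lambda,\phi_X)$ with $X$ a set and $\phi_X:\Lambda\times X\to\Lambda$ a map. A morphism $\mathscr{X}\to\mathscr{Y}$ is a map $f:\Lambda\times X\to Y$, $f_\lambda=f(\lambda,-)$, with $\phi_Y(\lambda,f_\lambda(x))=\phi_X(\lambda,x)$. The tensor product is $\mathscr{X}\otimes\mathscr{Y}=(X\times Y,\Lambda,\phi_{X\times Y})$, $\phi_{X\times Y}(\lambda,x,y)=\phi_Y(\phi_X(\lambda,x),y)$. Dynamical group: a dynamical set $\mathscr{G}=(G,\Lambda,\phi_G)$ with maps $\circ_\lambda:G\times G\to G$ such that $\phi_G(\lambda,a\circ_\lambda b)=\phi_G(\phi_G(\lambda,a),b)$ and $a\circ_\lambda(b\circ_{\phi_G(\lambda,a)}c)=(a\circ_\lambda b)\circ_\lambda c$; an element $e_G$ with $a\circ_\lambda e_G=e_G\circ_\lambda a=a$ and $\phi_G(\lambda,e_G)=\lambda$; and for all $\lambda,a$ a (unique) element $\bar a^\lambda$ with $a\circ_\lambda\bar a^\lambda=\bar a^\lambda\circ_{\phi_G(\lambda,a)}a=e_G$. A homomorphism of dynamical groups $(\mathscr{G},\circ)\to(\mathscr{H},\circ')$ is a morphism of dynamical sets $\Psi$ with $\Psi_\lambda(a\circ_\lambda b)=\Psi_\lambda(a)\circ'_\lambda\Psi_{\phi_G(\lambda,a)}(b)$. A constant dynamical group is a family of group structures $\cdot_\lambda$ ($\lambda\in\Lambda$) on one set with a common unit.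 Braided dynamical group $(\mathscr{G},\sigma)$: a dynamical group $(\mathscr{G},\circ)$ with a map $\sigma:\Lambda\times G\times G\to G\times G$, $\sigma(\lambda,a,b)=(a\rightharpoonup_\lambda b,\ a\leftharpoonup_\lambda b)$, which is a morphism of dynamical sets $\mathscr{G}\otimes\mathscr{G}\to\mathscr{G}\otimes\mathscr{G}$ such that for all $\lambda\in\Lambda$, $a,b,x,y\in G$: (1) $e_G\rightharpoonup_\lambda x=x$; (2) $(a\circ_\lambda b)\rightharpoonup_\lambda x=a\rightharpoonup_\lambda(b\rightharpoonup_{\phi_G(\lambda,a)}x)$; (3) $a\rightharpoonup_\lambda(x\circ_{\phi_G(\lambda,a)}y)=(a\rightharpoonup_\lambda x)\circ_\lambda\big((a\leftharpoonup_\lambda x)\rightharpoonup_{\phi_G(\lambda,a\rightharpoonup_\lambda x)}y\big)$; (4) $a\leftharpoonup_\lambda e_G=a$; (5) $a\leftharpoonup_\lambda(x\circ_{\phi_G(\lambda,a)}y)=(a\leftharpoonup_\lambda x)\leftharpoonup_{\phi_G(\lambda,a\rightharpoonup_\lambda x)}y$; (6) $(a\circ_\lambda b)\leftharpoonup_\lambda x=\big(a\leftharpoonup_\lambda(b\rightharpoonup_{\phi_G(\lambda,a)}x)\big)\circ_{\phi_G(\lambda,(a\circ_\lambda b)\rightharpoonup_\lambda x)}(b\leftharpoonup_{\phi_G(\lambda,a)}x)$; (7) $(a\rightharpoonup_\lambda b)\circ_\lambda(a\leftharpoonup_\lambda b)=a\circ_\lambda b$. A homomorphism of braided dynamical groups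 $(\mathscr{G},\sigma)\to(\mathscr{H},\sigma')$ is a homomorphism of dynamical groups $\Psi$ with $(\Psi\times\Psi)_\lambda\circ\sigma_\lambda=\sigma'_\lambda\circ(\Psi\times\Psi)_\lambda$ for all $\lambda$, where $(\Psi\times\Psi)_\lambda(a,b)=(\Psi_\lambda(a),\Psi_{\phi_G(\lambda,a)}(b))$. Dynamical post-group: a dynamical set $\mathscr{G}=(G,\Lambda,\phi_G)$ with maps $\cdot_\lambda,\vartriangleright_\lambda:G\times G\to G$ such that $(G,\Lambda,\{\cdot_\lambda\})$ is a constant dynamical group; $a\vartriangleright_\lambda(b\cdot_{\phi_G(\lambda,a)}c)=(a\vartriangleright_\lambda b)\cdot_\lambda(a\vartriangleright_\lambda c)$; $(a\cdot_\lambda(a\vartriangleright_\lambda b))\vartriangleright_\lambda c=a\vartriangleright_\lambda(b\vartriangleright_{\phi_G(\lambda,a)}c)$; and each map $b\mapsto a\vartriangleright_\lambda b$ is bijective. A homomorphism of dynamical post-groups is a morphism of dynamical sets $\Psi:\mathscr{G}\to\mathscr{H}$ with $\Psi_\lambda(a\cdot_\lambda b)=\Psi_\lambda(a)\cdot'_\lambda\Psi_\lambda(b)$ and $\Psi_\lambda(a\vartriangleright_\lambda b)=\Psi_\lambda(a)\vartriangleright'_\lambda\Psi_{\phi_G(\lambda,a)}(b)$. *)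

theory Defs
  imports "HOL-Algebra.Group"
begin

text \<open>All objects share one parameter set \<open>\<Lambda>\<close>, which is therefore an argument of the predicates
  below and not a record field. A map \<open>f : \<Lambda> \<times> X \<rightarrow> Y\<close> is a curried function of which only the
  values on \<open>\<Lambda>\<close> and \<open>carrier X\<close> matter; \<open>act X\<close> is the structure map of the dynamical set \<open>X\<close>.\<close>

record ('a, 'l) dyn_set = "'a partial_object" +
  act :: "'l \<Rightarrow> 'a \<Rightarrow> 'l"

locale dynamical_set =
  fixes \<Lambda> :: "'l set" and X :: "('a, 'l, 'm) dyn_set_scheme"
  assumes act_closed: "act X \<in> \<Lambda> \<rightarrow> carrier X \<rightarrow> \<Lambda>"

definition dyn_set_hom ::
  "'l set \<Rightarrow> ('a, 'l, 'm) dyn_set_scheme \<Rightarrow> ('b, 'l, 'n) dyn_set_scheme \<Rightarrow> ('l \<Rightarrow> 'a \<Rightarrow> 'b) set" where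
  "dyn_set_hom \<Lambda> X Y =
    {f. f \<in> \<Lambda> \<rightarrow> carrier X \<rightarrow> carrier Y \<and>
        (\<forall>l\<in>\<Lambda>. \<forall>x\<in>carrier X. act Y l (f l x) = act X l x)}"

definition dyn_tensor ::
  "('a, 'l, 'm) dyn_set_scheme \<Rightarrow> ('b, 'l, 'n) dyn_set_scheme \<Rightarrow> ('a \<times> 'b, 'l) dyn_set" where
  "dyn_tensor X Y =
    \<lparr>carrier = carrier X \<times> carrier Y, act = (\<lambda>l (x, y). act Y (act X l x) y)\<rparr>"


record ('a, 'l) dyn_group = "('a, 'l) dyn_set" +
  dmult :: "'l \<Rightarrow> 'a \<Rightarrow> 'a \<Rightarrow> 'a"
  dunit :: 'a

abbreviation dmult_at (\<open>(_ \<circ>\<^bsub>_,_\<^esub> _)\<close> [71, 0, 0, 71] 70) where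
  "a \<circ>\<^bsub>G,l\<^esub> b \<equiv> dmult G l a b"

locale dynamical_group = dynamical_set \<Lambda> G
  for \<Lambda> :: "'l set" and G :: "('a, 'l, 'm) dyn_group_scheme" +
  assumes dmult_closed: "\<lbrakk>l \<in> \<Lambda>; a \<in> carrier G; b \<in> carrier G\<rbrakk> \<Longrightarrow> a \<circ>\<^bsub>G,l\<^esub> b \<in> carrier G"
    and act_dmult: "\<lbrakk>l \<in> \<Lambda>; a \<in> carrier G; b \<in> carrier G\<rbrakk> \<Longrightarrow>
      act G l (a \<circ>\<^bsub>G,l\<^esub> b) = act G (act G l a) b"
    and dmult_assoc: "\<lbrakk>l \<in> \<Lambda>; a \<in> carrier G; b \<in> carrier G; c \<in> carrier G\<rbrakk> \<Longrightarrow>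
      a \<circ>\<^bsub>G,l\<^esub> (b \<circ>\<^bsub>G,act G l a\<^esub> c) = (a \<circ>\<^bsub>G,l\<^esub> b) \<circ>\<^bsub>G,l\<^esub> c"
    and dunit_closed: "dunit G \<in> carrier G"
    and dmult_dunit: "\<lbrakk>l \<in> \<Lambda>; a \<in> carrier G\<rbrakk> \<Longrightarrow> a \<circ>\<^bsub>G,l\<^esub> dunit G = a"
    and dunit_dmult: "\<lbrakk>l \<in> \<Lambda>; a \<in> carrier G\<rbrakk> \<Longrightarrow> dunit G \<circ>\<^bsub>G,l\<^esub> a = a"
    and act_dunit: "l \<in> \<Lambda> \<Longrightarrow> act G l (dunit G) = l"
    and inverse_exists: "\<lbrakk>l \<in> \<Lambda>; a \<in> carrier G\<rbrakk> \<Longrightarrow>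
      \<exists>b\<in>carrier G. a \<circ>\<^bsub>G,l\<^esub> b = dunit G \<and> b \<circ>\<^bsub>G,act G l a\<^esub> a = dunit G"

definition dyn_inv :: "('a, 'l, 'm) dyn_group_scheme \<Rightarrow> 'l \<Rightarrow> 'a \<Rightarrow> 'a" where
  "dyn_inv G l a =
    (THE b. b \<in> carrier G \<and> a \<circ>\<^bsub>G,l\<^esub> b = dunit G \<and> b \<circ>\<^bsub>G,act G l a\<^esub> a = dunit G)"

text \<open>Uniqueness of inverses follows from the other axioms, so \<open>dyn_inv\<close> is well defined.\<close>

lemma (in dynamical_group) inverse_unique:
  assumes l: "l \<in> \<Lambda>" and a: "a \<in> carrier G"
  shows "\<exists>!b. b \<in> carrier G \<and> a \<circ>\<^bsub>G,l\<^esub> b = dunit G \<and> b \<circ>\<^bsub>G,act G l a\<^esub> a = dunit G"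
proof -
  have la: "act G l a \<in> \<Lambda>"
    using act_closed l a by auto
  have "b = c" if b: "b \<in> carrier G" "a \<circ>\<^bsub>G,l\<^esub> b = dunit G" "b \<circ>\<^bsub>G,act G l a\<^esub> a = dunit G"
    and c: "c \<in> carrier G" "a \<circ>\<^bsub>G,l\<^esub> c = dunit G" for b c
  proof -
    have "act G (act G l a) b = l"
      using act_dmult[OF l a b(1)] act_dunit[OF l] b(2) by simp
    then have "b \<circ>\<^bsub>G,act G l a\<^esub> (a \<circ>\<^bsub>G,l\<^esub> c) = (b \<circ>\<^bsub>G,act G l a\<^esub> a) \<circ>\<^bsub>G,act G l a\<^esub> c"
      using dmult_assoc[OF la b(1) a c(1)] by simp
    then show ?thesis
      using b c la by (simp add: dmult_dunit dunit_dmult)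
  qed
  then show ?thesis
    using inverse_exists[OF l a] by metis
qed

lemma (in dynamical_group) dyn_inv_props:
  assumes "l \<in> \<Lambda>" and "a \<in> carrier G"
  shows "dyn_inv G l a \<in> carrier G" "a \<circ>\<^bsub>G,l\<^esub> dyn_inv G l a = dunit G"
    "dyn_inv G l a \<circ>\<^bsub>G,act G l a\<^esub> a = dunit G"
  using theI'[OF inverse_unique[OF assms]] by (simp_all add: dyn_inv_def)

definition dyn_group_hom ::
  "'l set \<Rightarrow> ('a, 'l, 'm) dyn_group_scheme \<Rightarrow> ('b, 'l, 'n) dyn_group_scheme \<Rightarrow> ('l \<Rightarrow> 'a \<Rightarrow> 'b) set" where
  "dyn_group_hom \<Lambda> G H =
    {\<Psi> \<in> dyn_set_hom \<Lambda> G H.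
      \<forall>l\<in>\<Lambda>. \<forall>a\<in>carrier G. \<forall>b\<in>carrier G.
        \<Psi> l (a \<circ>\<^bsub>G,l\<^esub> b) = \<Psi> l a \<circ>\<^bsub>H,l\<^esub> \<Psi> (act G l a) b}"


record ('a, 'l) braided_dyn_group = "('a, 'l) dyn_group" +
  braiding :: "'l \<Rightarrow> 'a \<times> 'a \<Rightarrow> 'a \<times> 'a"

abbreviation left_act_at (\<open>(_ \<rightharpoonup>\<^bsub>_,_\<^esub> _)\<close> [71, 0, 0, 71] 70) where
  "a \<rightharpoonup>\<^bsub>G,l\<^esub> b \<equiv> fst (braiding G l (a, b))"

abbreviation right_act_at (\<open>(_ \<leftharpoonup>\<^bsub>_,_\<^esub> _)\<close> [71, 0, 0, 71] 70) where
  "a \<leftharpoonup>\<^bsub>G,l\<^esub> b \<equiv> snd (braiding G l (a, b))"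

locale braided_dynamical_group = dynamical_group \<Lambda> G
  for \<Lambda> :: "'l set" and G :: "('a, 'l, 'm) braided_dyn_group_scheme" +
  assumes braiding_hom: "braiding G \<in> dyn_set_hom \<Lambda> (dyn_tensor G G) (dyn_tensor G G)"
    and unit_left_act: "\<lbrakk>l \<in> \<Lambda>; x \<in> carrier G\<rbrakk> \<Longrightarrow> dunit G \<rightharpoonup>\<^bsub>G,l\<^esub> x = x"
    and mult_left_act:
      "\<lbrakk>l \<in> \<Lambda>; a \<in> carrier G; b \<in> carrier G; x \<in> carrier G\<rbrakk> \<Longrightarrow>
        (a \<circ>\<^bsub>G,l\<^esub> b) \<rightharpoonup>\<^bsub>G,l\<^esub> x = a \<rightharpoonup>\<^bsub>G,l\<^esub> (b \<rightharpoonup>\<^bsub>G,act G l a\<^esub> x)"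
    and left_act_mult:
      "\<lbrakk>l \<in> \<Lambda>; a \<in> carrier G; x \<in> carrier G; y \<in> carrier G\<rbrakk> \<Longrightarrow>
        a \<rightharpoonup>\<^bsub>G,l\<^esub> (x \<circ>\<^bsub>G,act G l a\<^esub> y) =
          (a \<rightharpoonup>\<^bsub>G,l\<^esub> x) \<circ>\<^bsub>G,l\<^esub> ((a \<leftharpoonup>\<^bsub>G,l\<^esub> x) \<rightharpoonup>\<^bsub>G,act G l (a \<rightharpoonup>\<^bsub>G,l\<^esub> x)\<^esub> y)"
    and right_act_unit: "\<lbrakk>l \<in> \<Lambda>; a \<in> carrier G\<rbrakk> \<Longrightarrow> a \<leftharpoonup>\<^bsub>G,l\<^esub> dunit G = a"
    and right_act_mult:
      "\<lbrakk>l \<in> \<Lambda>; a \<in> carrier G; x \<in> carrier G; y \<in> carrier G\<rbrakk> \<Longrightarrow>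
        a \<leftharpoonup>\<^bsub>G,l\<^esub> (x \<circ>\<^bsub>G,act G l a\<^esub> y) =
          (a \<leftharpoonup>\<^bsub>G,l\<^esub> x) \<leftharpoonup>\<^bsub>G,act G l (a \<rightharpoonup>\<^bsub>G,l\<^esub> x)\<^esub> y"
    and mult_right_act:
      "\<lbrakk>l \<in> \<Lambda>; a \<in> carrier G; b \<in> carrier G; x \<in> carrier G\<rbrakk> \<Longrightarrow>
        (a \<circ>\<^bsub>G,l\<^esub> b) \<leftharpoonup>\<^bsub>G,l\<^esub> x =
          (a \<leftharpoonup>\<^bsub>G,l\<^esub> (b \<rightharpoonup>\<^bsub>G,act G l a\<^esub> x))
            \<circ>\<^bsub>G,act G l ((a \<circ>\<^bsub>G,l\<^esub> b) \<rightharpoonup>\<^bsub>G,l\<^esub> x)\<^esub> (b \<leftharpoonup>\<^bsub>G,act G l a\<^esub> x)"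
    and braided_comm:
      "\<lbrakk>l \<in> \<Lambda>; a \<in> carrier G; b \<in> carrier G\<rbrakk> \<Longrightarrow>
        (a \<rightharpoonup>\<^bsub>G,l\<^esub> b) \<circ>\<^bsub>G,l\<^esub> (a \<leftharpoonup>\<^bsub>G,l\<^esub> b) = a \<circ>\<^bsub>G,l\<^esub> b"

text \<open>The map \<open>\<Psi> \<times> \<Psi>\<close>; the parameter used on the second component is moved by the first.\<close>

definition dyn_prod_map ::
  "('a, 'l, 'm) dyn_set_scheme \<Rightarrow> ('l \<Rightarrow> 'a \<Rightarrow> 'b) \<Rightarrow> 'l \<Rightarrow> 'a \<times> 'a \<Rightarrow> 'b \<times> 'b" where
  "dyn_prod_map G \<Psi> l = (\<lambda>(a, b). (\<Psi> l a, \<Psi> (act G l a) b))"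

definition braided_dyn_group_hom ::
  "'l set \<Rightarrow> ('a, 'l, 'm) braided_dyn_group_scheme \<Rightarrow> ('b, 'l, 'n) braided_dyn_group_scheme \<Rightarrow>
    ('l \<Rightarrow> 'a \<Rightarrow> 'b) set" where
  "braided_dyn_group_hom \<Lambda> G H =
    {\<Psi> \<in> dyn_group_hom \<Lambda> G H.
      \<forall>l\<in>\<Lambda>. \<forall>p\<in>carrier G \<times> carrier G.
        dyn_prod_map G \<Psi> l (braiding G l p) = braiding H l (dyn_prod_map G \<Psi> l p)}"


definition constant_dyn_group :: "'l set \<Rightarrow> 'a set \<Rightarrow> ('l \<Rightarrow> 'a \<Rightarrow> 'a \<Rightarrow> 'a) \<Rightarrow> bool" where
  "constant_dyn_group \<Lambda> A m \<longleftrightarrow>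
    (\<exists>e\<in>A. \<forall>l\<in>\<Lambda>. group \<lparr>carrier = A, mult = m l, one = e\<rparr>)"

record ('a, 'l) dyn_post_group = "('a, 'l) dyn_set" +
  pmult :: "'l \<Rightarrow> 'a \<Rightarrow> 'a \<Rightarrow> 'a"
  ptri :: "'l \<Rightarrow> 'a \<Rightarrow> 'a \<Rightarrow> 'a"

abbreviation pmult_at (\<open>(_ \<cdot>\<^bsub>_,_\<^esub> _)\<close> [71, 0, 0, 71] 70) where
  "a \<cdot>\<^bsub>G,l\<^esub> b \<equiv> pmult G l a b"

abbreviation ptri_at (\<open>(_ \<rhd>\<^bsub>_,_\<^esub> _)\<close> [71, 0, 0, 71] 70) where
  "a \<rhd>\<^bsub>G,l\<^esub> b \<equiv> ptri G l a b"

locale dynamical_post_group = dynamical_set \<Lambda> G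
  for \<Lambda> :: "'l set" and G :: "('a, 'l, 'm) dyn_post_group_scheme" +
  assumes pmult_constant: "constant_dyn_group \<Lambda> (carrier G) (pmult G)"
    and ptri_pmult:
      "\<lbrakk>l \<in> \<Lambda>; a \<in> carrier G; b \<in> carrier G; c \<in> carrier G\<rbrakk> \<Longrightarrow>
        a \<rhd>\<^bsub>G,l\<^esub> (b \<cdot>\<^bsub>G,act G l a\<^esub> c) = (a \<rhd>\<^bsub>G,l\<^esub> b) \<cdot>\<^bsub>G,l\<^esub> (a \<rhd>\<^bsub>G,l\<^esub> c)"
    and pmult_ptri:
      "\<lbrakk>l \<in> \<Lambda>; a \<in> carrier G; b \<in> carrier G; c \<in> carrier G\<rbrakk> \<Longrightarrow>
        (a \<cdot>\<^bsub>G,l\<^esub> (a \<rhd>\<^bsub>G,l\<^esub> b)) \<rhd>\<^bsub>G,l\<^esub> c = a \<rhd>\<^bsub>G,l\<^esub> (b \<rhd>\<^bsub>G,act G l a\<^esub> c)"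
    and ptri_bij:
      "\<lbrakk>l \<in> \<Lambda>; a \<in> carrier G\<rbrakk> \<Longrightarrow> bij_betw (\<lambda>b. a \<rhd>\<^bsub>G,l\<^esub> b) (carrier G) (carrier G)"

definition dyn_post_group_hom ::
  "'l set \<Rightarrow> ('a, 'l, 'm) dyn_post_group_scheme \<Rightarrow> ('b, 'l, 'n) dyn_post_group_scheme \<Rightarrow>
    ('l \<Rightarrow> 'a \<Rightarrow> 'b) set" where
  "dyn_post_group_hom \<Lambda> G H =
    {\<Psi> \<in> dyn_set_hom \<Lambda> G H.
      \<forall>l\<in>\<Lambda>. \<forall>a\<in>carrier G. \<forall>b\<in>carrier G.
        \<Psi> l (a \<cdot>\<^bsub>G,l\<^esub> b) = \<Psi> l a \<cdot>\<^bsub>H,l\<^esub> \<Psi> l b \<and>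
        \<Psi> l (a \<rhd>\<^bsub>G,l\<^esub> b) = \<Psi> l a \<rhd>\<^bsub>H,l\<^esub> \<Psi> (act G l a) b}"

definition post_group_of :: "('a, 'l, 'm) braided_dyn_group_scheme \<Rightarrow> ('a, 'l) dyn_post_group" where
  "post_group_of G =
    \<lparr>carrier = carrier G, act = act G,
     pmult = (\<lambda>l a b. a \<circ>\<^bsub>G,l\<^esub> (dyn_inv G l a \<rightharpoonup>\<^bsub>G,act G l a\<^esub> b)),
     ptri = (\<lambda>l a b. a \<rightharpoonup>\<^bsub>G,l\<^esub> b)\<rparr>"

end

theory Submission
  imports Defs
begin

text \<open>Each map \<open>b \<mapsto> a \<rhd>\<^bsub>\<lambda>\<^esub> b\<close> is invertible, so every element of \<open>G\<close> can be written as
  \<open>a \<rhd>\<^bsub>\<lambda>\<^esub> b\<close>, and the product \<open>\<cdot>\<close> is characterised by \<open>a \<cdot>\<^bsub>\<lambda>\<^esub> (a \<rhd>\<^bsub>\<lambda>\<^esub> b) = a \<circ>\<^bsub>\<lambda>\<^esub> b\<close>. In this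
  form axioms (2), (3) and (7) give the distributivity of \<open>\<rhd>\<close> over \<open>\<cdot>\<close>, which turns associativity
  of \<open>\<circ>\<close> into associativity of \<open>\<cdot>\<close>. The remaining point is that the unit is a right unit of \<open>\<cdot>\<close>,
  that is \<open>a \<rightharpoonup> e = e\<close>.\<close>

context dynamical_group
begin

lemma act_in: "\<lbrakk>l \<in> \<Lambda>; a \<in> carrier G\<rbrakk> \<Longrightarrow> act G l a \<in> \<Lambda>"
  using act_closed by auto

lemma act_dyn_inv: "\<lbrakk>l \<in> \<Lambda>; a \<in> carrier G\<rbrakk> \<Longrightarrow> act G (act G l a) (dyn_inv G l a) = l"
  using act_dmult[of l a "dyn_inv G l a"] by (simp add: dyn_inv_props act_dunit)

lemma dmult_left_cancel:
  assumes "l \<in> \<Lambda>" "x \<in> carrier G" "y \<in> carrier G" "z \<in> carrier G"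
    and "x \<circ>\<^bsub>G,l\<^esub> y = x \<circ>\<^bsub>G,l\<^esub> z"
  shows "y = z"
proof -
  \<comment> \<open>The inverse acts at the parameter moved by \<open>x\<close>. By
    \<open>act_dyn_inv\<close> it moves the parameter back to \<open>l\<close>, which is what lets
    \<open>dmult_assoc\<close> apply.\<close>
  have "dyn_inv G l x \<circ>\<^bsub>G,act G l x\<^esub> (x \<circ>\<^bsub>G,l\<^esub> w) = w" if "w \<in> carrier G" for w
    using dmult_assoc[of "act G l x" "dyn_inv G l x" x w] assms that
    by (simp add: dyn_inv_props act_dyn_inv act_in dunit_dmult)
  then show ?thesis
    using assms by metis
qed

end

context braided_dynamical_group
begin

lemma left_act_closed: "\<lbrakk>l \<in> \<Lambda>; a \<in> carrier G; b \<in> carrier G\<rbrakk> \<Longrightarrow> a \<rightharpoonup>\<^bsub>G,l\<^esub> b \<in> carrier G"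
  and right_act_closed: "\<lbrakk>l \<in> \<Lambda>; a \<in> carrier G; b \<in> carrier G\<rbrakk> \<Longrightarrow> a \<leftharpoonup>\<^bsub>G,l\<^esub> b \<in> carrier G"
  using braiding_hom by (fastforce simp: dyn_set_hom_def dyn_tensor_def Pi_iff mem_Times_iff)+

text \<open>Axiom (2) applied to the two products of \<open>a\<close> with its inverse, both equal
  to the unit, which acts trivially by (1).\<close>

lemma left_act_dyn_inv:
  assumes "l \<in> \<Lambda>" "a \<in> carrier G" "b \<in> carrier G"
  shows "a \<rightharpoonup>\<^bsub>G,l\<^esub> (dyn_inv G l a \<rightharpoonup>\<^bsub>G,act G l a\<^esub> b) = b"
    and "dyn_inv G l a \<rightharpoonup>\<^bsub>G,act G l a\<^esub> (a \<rightharpoonup>\<^bsub>G,l\<^esub> b) = b"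
  using assms mult_left_act[of l a "dyn_inv G l a" b]
    mult_left_act[of "act G l a" "dyn_inv G l a" a b]
  by (simp_all add: dyn_inv_props act_dyn_inv act_in unit_left_act)

lemma left_act_surj:
  assumes "l \<in> \<Lambda>" "a \<in> carrier G" "b \<in> carrier G"
  obtains b' where "b' \<in> carrier G" "b = a \<rightharpoonup>\<^bsub>G,l\<^esub> b'"
  using assms by (metis left_act_dyn_inv(1) left_act_closed act_in dyn_inv_props(1))

lemma left_act_bij:
  assumes "l \<in> \<Lambda>" "a \<in> carrier G"
  shows "bij_betw (\<lambda>b. a \<rightharpoonup>\<^bsub>G,l\<^esub> b) (carrier G) (carrier G)"
  by (rule bij_betw_byWitness[where f' = "\<lambda>b. dyn_inv G l a \<rightharpoonup>\<^bsub>G,act G l a\<^esub> b"])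
    (use assms in \<open>auto simp: left_act_dyn_inv left_act_closed act_in dyn_inv_props\<close>)

text \<open>Write \<open>u = a \<rightharpoonup>\<^bsub>\<lambda>\<^esub> e\<close> and \<open>\<mu> = \<phi>(\<lambda>, u)\<close>. Axiom (3) only gives \<open>a \<rightharpoonup>\<^bsub>\<mu>\<^esub> e = e\<close>, with the shifted
  parameter; combined with \<open>u \<circ>\<^bsub>\<lambda>\<^esub> a = a\<close> from (7) it shows \<open>u \<rightharpoonup>\<^bsub>\<lambda>\<^esub> e = u\<close>, and then (7) again
  makes \<open>u\<close> idempotent.\<close>

lemma left_act_unit:
  assumes l: "l \<in> \<Lambda>" and a: "a \<in> carrier G"
  shows "a \<rightharpoonup>\<^bsub>G,l\<^esub> dunit G = dunit G"
proof -
  define u where "u = a \<rightharpoonup>\<^bsub>G,l\<^esub> dunit G"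
  define m where "m = act G l u"
  have u: "u \<in> carrier G" and m: "m \<in> \<Lambda>"
    using l a by (simp_all add: u_def m_def left_act_closed dunit_closed act_in)
  have "u \<circ>\<^bsub>G,l\<^esub> (a \<rightharpoonup>\<^bsub>G,m\<^esub> dunit G) = u \<circ>\<^bsub>G,l\<^esub> dunit G"
    using left_act_mult[OF l a dunit_closed dunit_closed] l a u
    by (simp add: u_def m_def dmult_dunit dunit_closed right_act_unit act_in)
  then have shifted: "a \<rightharpoonup>\<^bsub>G,m\<^esub> dunit G = dunit G"
    using dmult_left_cancel l u left_act_closed m a dunit_closed by blast
  have "u \<circ>\<^bsub>G,l\<^esub> a = a"
    using braided_comm[OF l a dunit_closed] l a by (simp add: u_def right_act_unit dmult_dunit)
  then have "u \<rightharpoonup>\<^bsub>G,l\<^esub> dunit G = u"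
    using mult_left_act[OF l u a dunit_closed] shifted by (simp add: u_def m_def)
  then have "u \<circ>\<^bsub>G,l\<^esub> u = u \<circ>\<^bsub>G,l\<^esub> dunit G"
    using braided_comm[OF l u dunit_closed] l u by (simp add: right_act_unit)
  then show ?thesis
    using dmult_left_cancel[OF l u u dunit_closed] by (simp add: u_def)
qed

lemma pmult_closed:
  "\<lbrakk>l \<in> \<Lambda>; a \<in> carrier G; b \<in> carrier G\<rbrakk> \<Longrightarrow> a \<cdot>\<^bsub>post_group_of G,l\<^esub> b \<in> carrier G"
  by (simp add: post_group_of_def dmult_closed left_act_closed act_in dyn_inv_props)

lemma pmult_left_act:
  "\<lbrakk>l \<in> \<Lambda>; a \<in> carrier G; b \<in> carrier G\<rbrakk> \<Longrightarrow>
    a \<cdot>\<^bsub>post_group_of G,l\<^esub> (a \<rightharpoonup>\<^bsub>G,l\<^esub> b) = a \<circ>\<^bsub>G,l\<^esub> b"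
  by (simp add: post_group_of_def left_act_dyn_inv)

text \<open>With \<open>c = b \<rightharpoonup> d\<close> the inner product is
  \<open>b \<circ> d\<close>, so axiom (3) expands the left side into a
  \<open>\<circ>\<close>-product with first factor \<open>p\<close>, which is read back as a
  \<open>\<cdot>\<close>-product.\<close>

lemma left_act_pmult:
  assumes l: "l \<in> \<Lambda>" and a: "a \<in> carrier G" and b: "b \<in> carrier G" and c: "c \<in> carrier G"
  shows "a \<rightharpoonup>\<^bsub>G,l\<^esub> (b \<cdot>\<^bsub>post_group_of G,act G l a\<^esub> c) =
    (a \<rightharpoonup>\<^bsub>G,l\<^esub> b) \<cdot>\<^bsub>post_group_of G,l\<^esub> (a \<rightharpoonup>\<^bsub>G,l\<^esub> c)"
proof -
  have la: "act G l a \<in> \<Lambda>"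
    using l a by (rule act_in)
  obtain d where d: "d \<in> carrier G" and c_eq: "c = b \<rightharpoonup>\<^bsub>G,act G l a\<^esub> d"
    using left_act_surj[OF la b c] .
  define p q where "p = a \<rightharpoonup>\<^bsub>G,l\<^esub> b" and "q = a \<leftharpoonup>\<^bsub>G,l\<^esub> b"
  have p: "p \<in> carrier G" and q: "q \<in> carrier G"
    using l a b by (simp_all add: p_def q_def left_act_closed right_act_closed)
  have lp: "act G l p \<in> \<Lambda>"
    using l p by (rule act_in)
  have "a \<rightharpoonup>\<^bsub>G,l\<^esub> (b \<cdot>\<^bsub>post_group_of G,act G l a\<^esub> c) = p \<circ>\<^bsub>G,l\<^esub> (q \<rightharpoonup>\<^bsub>G,act G l p\<^esub> d)"
    using left_act_mult[OF l a b d] by (simp add: c_eq pmult_left_act la b d p_def q_def)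
  also have "\<dots> = p \<cdot>\<^bsub>post_group_of G,l\<^esub> (p \<rightharpoonup>\<^bsub>G,l\<^esub> (q \<rightharpoonup>\<^bsub>G,act G l p\<^esub> d))"
    using l p q d lp by (simp add: pmult_left_act left_act_closed)
  also have "p \<rightharpoonup>\<^bsub>G,l\<^esub> (q \<rightharpoonup>\<^bsub>G,act G l p\<^esub> d) = (p \<circ>\<^bsub>G,l\<^esub> q) \<rightharpoonup>\<^bsub>G,l\<^esub> d"
    using mult_left_act[OF l p q d] by simp
  \<comment> \<open>Axiom (7) says \<open>p \<circ> q = a \<circ> b\<close>, and by (2) the latter
    sends \<open>d\<close> to \<open>a \<rightharpoonup> c\<close>.\<close>
  also have "\<dots> = a \<rightharpoonup>\<^bsub>G,l\<^esub> c"
    using mult_left_act[OF l a b d] braided_comm[OF l a b] by (simp add: p_def q_def c_eq)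
  finally show ?thesis
    by (simp add: p_def)
qed

lemma pmult_assoc:
  assumes l: "l \<in> \<Lambda>" and a: "a \<in> carrier G" and b: "b \<in> carrier G" and c: "c \<in> carrier G"
  shows "(a \<cdot>\<^bsub>post_group_of G,l\<^esub> b) \<cdot>\<^bsub>post_group_of G,l\<^esub> c =
    a \<cdot>\<^bsub>post_group_of G,l\<^esub> (b \<cdot>\<^bsub>post_group_of G,l\<^esub> c)"
proof -
  have la: "act G l a \<in> \<Lambda>"
    using l a by (rule act_in)
  obtain b' where b': "b' \<in> carrier G" and b_eq: "b = a \<rightharpoonup>\<^bsub>G,l\<^esub> b'"
    using left_act_surj[OF l a b] .
  have ab': "a \<circ>\<^bsub>G,l\<^esub> b' \<in> carrier G"
    using l a b' by (rule dmult_closed)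
  \<comment> \<open>Since \<open>a \<cdot> b = a \<circ> b'\<close>, the preimage of
    \<open>c\<close> is taken under this element, so that the outer product becomes a
    \<open>\<circ>\<close>-product too.\<close>
  obtain d where d: "d \<in> carrier G" and c_eq: "c = (a \<circ>\<^bsub>G,l\<^esub> b') \<rightharpoonup>\<^bsub>G,l\<^esub> d"
    using left_act_surj[OF l ab' c] .
  have "(a \<cdot>\<^bsub>post_group_of G,l\<^esub> b) \<cdot>\<^bsub>post_group_of G,l\<^esub> c = (a \<circ>\<^bsub>G,l\<^esub> b') \<circ>\<^bsub>G,l\<^esub> d"
    by (simp add: b_eq c_eq pmult_left_act l a b' d ab')
  also have "\<dots> = a \<circ>\<^bsub>G,l\<^esub> (b' \<circ>\<^bsub>G,act G l a\<^esub> d)"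
    using dmult_assoc[OF l a b' d] by simp
  also have "\<dots> = a \<cdot>\<^bsub>post_group_of G,l\<^esub> (a \<rightharpoonup>\<^bsub>G,l\<^esub> (b' \<circ>\<^bsub>G,act G l a\<^esub> d))"
    by (simp add: pmult_left_act dmult_closed l a la b' d)
  \<comment> \<open>Returning to \<open>\<cdot>\<close> inside makes distributivity applicable; its
    second factor \<open>a \<rightharpoonup> (b' \<rightharpoonup> d)\<close> is \<open>c\<close> by
    (2).\<close>
  also have "b' \<circ>\<^bsub>G,act G l a\<^esub> d =
      b' \<cdot>\<^bsub>post_group_of G,act G l a\<^esub> (b' \<rightharpoonup>\<^bsub>G,act G l a\<^esub> d)"
    by (simp add: pmult_left_act la b' d)
  also have "a \<rightharpoonup>\<^bsub>G,l\<^esub> \<dots> = b \<cdot>\<^bsub>post_group_of G,l\<^esub> c"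
    by (simp add: left_act_pmult left_act_closed mult_left_act b_eq c_eq l a la b' d)
  finally show ?thesis .
qed

lemma dunit_pmult:
  assumes "l \<in> \<Lambda>" "a \<in> carrier G"
  shows "dunit G \<cdot>\<^bsub>post_group_of G,l\<^esub> a = a"
  using pmult_left_act[of l "dunit G" a] assms by (simp add: dunit_closed unit_left_act dunit_dmult)

lemma pmult_dunit:
  assumes "l \<in> \<Lambda>" "a \<in> carrier G"
  shows "a \<cdot>\<^bsub>post_group_of G,l\<^esub> dunit G = a"
  using pmult_left_act[of l a "dunit G"] assms by (simp add: dunit_closed left_act_unit dmult_dunit)

text \<open>The witness is \<open>a \<rightharpoonup> dyn_inv G l a\<close>, whose
  \<open>\<cdot>\<close>-product with \<open>a\<close> is
  \<open>a \<circ> dyn_inv G l a\<close>.\<close>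

lemma pmult_right_inverse:
  assumes "l \<in> \<Lambda>" "a \<in> carrier G"
  obtains b where "b \<in> carrier G" "a \<cdot>\<^bsub>post_group_of G,l\<^esub> b = dunit G"
  using assms pmult_left_act[of l a "dyn_inv G l a"] that[of "a \<rightharpoonup>\<^bsub>G,l\<^esub> dyn_inv G l a"]
  by (simp add: dyn_inv_props left_act_closed)

lemma pmult_group:
  assumes l: "l \<in> \<Lambda>"
  shows "group \<lparr>carrier = carrier G, mult = pmult (post_group_of G) l, one = dunit G\<rparr>"
proof (rule groupI; simp add: pmult_closed pmult_assoc dunit_closed dunit_pmult l)
  fix a assume a: "a \<in> carrier G"
  obtain b where b: "b \<in> carrier G" and ab: "a \<cdot>\<^bsub>post_group_of G,l\<^esub> b = dunit G"
    using pmult_right_inverse[OF l a] .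
  obtain c where c: "c \<in> carrier G" and bc: "b \<cdot>\<^bsub>post_group_of G,l\<^esub> c = dunit G"
    using pmult_right_inverse[OF l b] .
  \<comment> \<open>\<open>groupI\<close> asks for left inverses. Bracketing
    \<open>a \<cdot> b \<cdot> c\<close> in both ways identifies \<open>a\<close> with the right
    inverse of \<open>b\<close>, so \<open>b\<close> is also a left inverse of
    \<open>a\<close>.\<close>
  have "a = c"
    using pmult_assoc[OF l a b c] by (simp add: ab bc dunit_pmult pmult_dunit l a c)
  then show "\<exists>b\<in>carrier G. b \<cdot>\<^bsub>post_group_of G,l\<^esub> a = dunit G"
    using b bc by blast
qed

theorem dynamical_post_group_post_group_of: "dynamical_post_group \<Lambda> (post_group_of G)"
proof
  have [simp]: "carrier (post_group_of G) = carrier G" "act (post_group_of G) = act G"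
    "ptri (post_group_of G) = (\<lambda>l a b. a \<rightharpoonup>\<^bsub>G,l\<^esub> b)"
    by (simp_all add: post_group_of_def)
  show "act (post_group_of G) \<in> \<Lambda> \<rightarrow> carrier (post_group_of G) \<rightarrow> \<Lambda>"
    using act_closed by simp
  show "constant_dyn_group \<Lambda> (carrier (post_group_of G)) (pmult (post_group_of G))"
    using pmult_group dunit_closed by (auto simp: constant_dyn_group_def)
  fix l a assume la: "l \<in> \<Lambda>" "a \<in> carrier (post_group_of G)"
  show "bij_betw (\<lambda>b. a \<rhd>\<^bsub>post_group_of G,l\<^esub> b) (carrier (post_group_of G))
      (carrier (post_group_of G))"
    using la left_act_bij by simp
  fix b c assume bc: "b \<in> carrier (post_group_of G)" "c \<in> carrier (post_group_of G)"
  show "a \<rhd>\<^bsub>post_group_of G,l\<^esub> (b \<cdot>\<^bsub>post_group_of G,act (post_group_of G) l a\<^esub> c) =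
      (a \<rhd>\<^bsub>post_group_of G,l\<^esub> b) \<cdot>\<^bsub>post_group_of G,l\<^esub> (a \<rhd>\<^bsub>post_group_of G,l\<^esub> c)"
    using la bc left_act_pmult by simp
  \<comment> \<open>The product on the left collapses to \<open>a \<circ> b\<close>, which leaves
    axiom (2).\<close>
  show "(a \<cdot>\<^bsub>post_group_of G,l\<^esub> (a \<rhd>\<^bsub>post_group_of G,l\<^esub> b)) \<rhd>\<^bsub>post_group_of G,l\<^esub> c =
      a \<rhd>\<^bsub>post_group_of G,l\<^esub> (b \<rhd>\<^bsub>post_group_of G,act (post_group_of G) l a\<^esub> c)"
    using la bc by (simp add: pmult_left_act mult_left_act)
qed

end

theorem braided_dyn_group_hom_imp_post_group_hom:
  assumes "braided_dynamical_group \<Lambda> G" and "braided_dynamical_group \<Lambda> H"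
    and \<Psi>: "\<Psi> \<in> braided_dyn_group_hom \<Lambda> G H"
  shows "\<Psi> \<in> dyn_post_group_hom \<Lambda> (post_group_of G) (post_group_of H)"
proof -
  interpret G: braided_dynamical_group \<Lambda> G by fact
  interpret H: braided_dynamical_group \<Lambda> H by fact
  have set_hom: "\<Psi> \<in> dyn_set_hom \<Lambda> G H"
    using \<Psi> by (simp add: braided_dyn_group_hom_def dyn_group_hom_def)
  then have closed: "\<Psi> l a \<in> carrier H" if "l \<in> \<Lambda>" "a \<in> carrier G" for l a
    using that by (auto simp: dyn_set_hom_def)
  have mult: "\<Psi> l (a \<circ>\<^bsub>G,l\<^esub> b) = \<Psi> l a \<circ>\<^bsub>H,l\<^esub> \<Psi> (act G l a) b"
    if "l \<in> \<Lambda>" "a \<in> carrier G" "b \<in> carrier G" for l a b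
    using \<Psi> that by (simp add: braided_dyn_group_hom_def dyn_group_hom_def)
  have left: "\<Psi> l (a \<rightharpoonup>\<^bsub>G,l\<^esub> b) = \<Psi> l a \<rightharpoonup>\<^bsub>H,l\<^esub> \<Psi> (act G l a) b"
    if "l \<in> \<Lambda>" "a \<in> carrier G" "b \<in> carrier G" for l a b
  proof -
    \<comment> \<open>The first component of this equation of pairs is the claim.\<close>
    have "dyn_prod_map G \<Psi> l (braiding G l (a, b)) = braiding H l (dyn_prod_map G \<Psi> l (a, b))"
      using \<Psi> that by (simp add: braided_dyn_group_hom_def)
    then show ?thesis
      by (simp add: dyn_prod_map_def split_beta prod_eq_iff)
  qed
  have pmult: "\<Psi> l (a \<cdot>\<^bsub>post_group_of G,l\<^esub> b) = \<Psi> l a \<cdot>\<^bsub>post_group_of H,l\<^esub> \<Psi> l b"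
    if l: "l \<in> \<Lambda>" and a: "a \<in> carrier G" and b: "b \<in> carrier G" for l a b
  proof -
    \<comment> \<open>In terms of \<open>b'\<close> both sides become
      \<open>\<Psi> l a \<circ> \<Psi> (act G l a) b'\<close>, so the inverses in the definition of
      \<open>\<cdot>\<close> never have to be compared.\<close>
    obtain b' where "b' \<in> carrier G" "b = a \<rightharpoonup>\<^bsub>G,l\<^esub> b'"
      using G.left_act_surj[OF l a b] .
    then show ?thesis
      using l a by (simp add: G.pmult_left_act H.pmult_left_act mult left closed G.act_in)
  qed
  have "\<Psi> \<in> dyn_set_hom \<Lambda> (post_group_of G) (post_group_of H)"
    using set_hom by (simp add: dyn_set_hom_def post_group_of_def)
  moreover have "carrier (post_group_of G) = carrier G" "act (post_group_of G) = act G"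
    "ptri (post_group_of G) = (\<lambda>l a b. a \<rightharpoonup>\<^bsub>G,l\<^esub> b)"
    "ptri (post_group_of H) = (\<lambda>l a b. a \<rightharpoonup>\<^bsub>H,l\<^esub> b)"
    by (simp_all add: post_group_of_def)
  ultimately show ?thesis
    by (simp add: dyn_post_group_hom_def pmult left)
qed

theorem proposition4p14:
  fixes \<Lambda> :: "'l set"
    and G :: "('a, 'l) braided_dyn_group"
  assumes "\<Lambda> \<noteq> {}"
    and "braided_dynamical_group \<Lambda> G"
  shows "dynamical_post_group \<Lambda> (post_group_of G) \<and>
    (\<forall>(H :: ('b, 'l) braided_dyn_group) \<Psi>.
      braided_dynamical_group \<Lambda> H \<longrightarrow> \<Psi> \<in> braided_dyn_group_hom \<Lambda> G H \<longrightarrow>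
      \<Psi> \<in> dyn_post_group_hom \<Lambda> (post_group_of G) (post_group_of H))"
  using braided_dynamical_group.dynamical_post_group_post_group_of[OF assms(2)]
    braided_dyn_group_hom_imp_post_group_hom[OF assms(2)] by blast

end
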